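(* Let $(\mathbb R^n,F)$ be a reversible Finsler-Minkowski space, and let $d_F(p,q)=F(q-p)$ for $p,q\in\mathbb R^n$. Then $(\mathbb R^n,d_F)$ satisfies the global double-projection property.
   Context: Finsler-Minkowski spaces. A positively homogeneous Minkowski norm is a function $F:\mathbb R^n\to[0,\infty)$ such that: (a) $F\in C^2(\mathbb R^n\setminus\{0\})$; (b) $F(ty)=tF(y)$ for all $t\ge 0$ and $y\in\mathbb R^n$; (c) the Hessian matrix $g_y=\nabla^2(F^2/2)(y)$ is positive definite for all $y\ne 0$. The pair $(\mathbb R^n,F)$ is then called a Finsler-Minkowski space. It is called reversible if $F$ is absolutely homogeneous, i.e. $F(ty)=|t|F(y)$ for all $t\in\mathbb R$, $y\in\mathbb R^n$. In the reversible case $d_F(p,q)=F(q-p)$ is a metric on $\mathbb R^n$. The geodesics of $(\mathbb R^n,d_F)$ are straight lines. Geodesics in a metric space $(M,d)$. The length of a continuous curve $\gamma:[0,1]\to M$ is $l(\gamma)=\sup\{\sum_{i=1}^m d(\gamma(t_{i-1}),\gamma(t_i)) : 0=t_0<\dots<t_m=1,\ m\in\mathbb N\}$. A geodesic segment joining $p$ to $q$ is a continuous curve $\gamma:[0,1]\to M$ with $\gamma(0)=p$, $\gamma(1)=q$ and $l(\gamma)=d(p,q)$, parametrized proportionally to arc-length. $(M,d)$ is a geodesic length space if every two points are joined by a geodesic segment. A set $S\subset M$ is geodesic convex if for every two points $p,q\in S$ there exists a unique geodesic segment joining $p$ to $q$ whose image is contained in $S$. Metric projection. For a nonempty set $S\subset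 M$ and $q\in M$, $P_S(q)=\{s\in S: d(q,s)=\inf_{z\in S}d(q,z)\}$. $S$ is $M$-proximinal if $P_S(q)\ne\emptyset$ for every $q\in M$. For sets $S_1,S_2$, $(P_{S_1}\circ P_{S_2})(q)=\bigcup_{s\in P_{S_2}(q)}P_{S_1}(s)$. Global double-projection property. $(M,d)$ satisfies the global double-projection property if $(M,d)$ is a geodesic length space and for every two (nonempty) geodesic convex, $M$-proximinal sets $S_1,S_2\subset M$ and every $q\in S_1$ the following two statements are equivalent: $(DP_1)$ $q\in (P_{S_1}\circ P_{S_2})(q)$; $(DP_2)$ there exists $\tilde q\in P_{S_2}(q)$ such that $d(q,\tilde q)\le d(z_1,z_2)$ for all $z_1\in S_1$, $z_2\in S_2$. *)

theory Defs
  imports "HOL-Analysis.Analysis"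
begin

section \<open>Finsler-Minkowski spaces\<close>

definition partial_deriv :: "'n \<Rightarrow> (real^'n \<Rightarrow> real) \<Rightarrow> real^'n \<Rightarrow> real" where
  "partial_deriv i f x = frechet_derivative f (at x) (axis i 1)"

text \<open>Intended for open \<open>S\<close> only: derivatives are taken in the full space.\<close>

primrec Ck_on :: "nat \<Rightarrow> (real^'n \<Rightarrow> real) \<Rightarrow> (real^'n) set \<Rightarrow> bool" where
  "Ck_on 0 f S \<longleftrightarrow> continuous_on S f"
| "Ck_on (Suc k) f S \<longleftrightarrow>
     (\<forall>x\<in>S. f differentiable (at x)) \<and> (\<forall>i. Ck_on k (partial_deriv i f) S)"

definition hessian :: "(real^'n \<Rightarrow> real) \<Rightarrow> real^'n \<Rightarrow> real^'n^'n" where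
  "hessian f x = (\<chi> i j. partial_deriv i (partial_deriv j f) x)"

text \<open>Symmetry is not demanded: it is automatic for the Hessian of a \<open>C\<^sup>2\<close> function.\<close>

definition positive_definite :: "real^'n^'n \<Rightarrow> bool" where
  "positive_definite A \<longleftrightarrow> (\<forall>v. v \<noteq> 0 \<longrightarrow> v \<bullet> (A *v v) > 0)"

definition minkowski_norm :: "(real^'n \<Rightarrow> real) \<Rightarrow> bool" where
  "minkowski_norm F \<longleftrightarrow>
     (\<forall>y. F y \<ge> 0) \<and>
     Ck_on 2 F (UNIV - {0}) \<and>
     (\<forall>t y. t \<ge> 0 \<longrightarrow> F (t *\<^sub>R y) = t * F y) \<and>
     (\<forall>y. y \<noteq> 0 \<longrightarrow> positive_definite (hessian (\<lambda>x. (F x)\<^sup>2 / 2) y))"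

definition reversible :: "(real^'n \<Rightarrow> real) \<Rightarrow> bool" where
  "reversible F \<longleftrightarrow> (\<forall>t y. F (t *\<^sub>R y) = \<bar>t\<bar> * F y)"

definition minkowski_dist :: "(real^'n \<Rightarrow> real) \<Rightarrow> real^'n \<Rightarrow> real^'n \<Rightarrow> real" where
  "minkowski_dist F p q = F (q - p)"

section \<open>Geodesics in a metric space \<open>(M, d)\<close>\<close>

text \<open>The length of the restriction of \<open>\<gamma>\<close> to \<open>[a, b]\<close>, possibly infinite. The trivial
  partition \<open>m = 0\<close> occurs exactly when \<open>a = b\<close>.\<close>

definition curve_length ::
    "('a \<Rightarrow> 'a \<Rightarrow> real) \<Rightarrow> (real \<Rightarrow> 'a) \<Rightarrow> real \<Rightarrow> real \<Rightarrow> ereal" where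
  "curve_length d \<gamma> a b =
     Sup {ereal (\<Sum>i=1..m. d (\<gamma> (t (i - 1))) (\<gamma> (t i))) | (m::nat) (t::nat \<Rightarrow> real).
            t 0 = a \<and> t m = b \<and> (\<forall>i\<in>{1..m}. t (i - 1) < t i)}"

text \<open>The last conjunct is the proportionality to arc-length.\<close>

definition geodesic_segment ::
    "'a set \<Rightarrow> ('a \<Rightarrow> 'a \<Rightarrow> real) \<Rightarrow> 'a \<Rightarrow> 'a \<Rightarrow> (real \<Rightarrow> 'a) \<Rightarrow> bool" where
  "geodesic_segment M d p q \<gamma> \<longleftrightarrow>
     continuous_map (top_of_set {0..1}) (Metric_space.mtopology M d) \<gamma> \<and>
     \<gamma> 0 = p \<and> \<gamma> 1 = q \<and>
     curve_length d \<gamma> 0 1 = ereal (d p q) \<and>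
     (\<forall>t\<in>{0..1}. curve_length d \<gamma> 0 t = ereal t * curve_length d \<gamma> 0 1)"

definition geodesic_length_space :: "'a set \<Rightarrow> ('a \<Rightarrow> 'a \<Rightarrow> real) \<Rightarrow> bool" where
  "geodesic_length_space M d \<longleftrightarrow>
     Metric_space M d \<and> (\<forall>p\<in>M. \<forall>q\<in>M. \<exists>\<gamma>. geodesic_segment M d p q \<gamma>)"

text \<open>A curve on \<open>[0, 1]\<close> is represented by a function on all reals; membership in
  \<^term>\<open>extensional {0..1}\<close> makes uniqueness refer to the values on \<open>[0, 1]\<close> only.\<close>

definition geodesic_convex :: "'a set \<Rightarrow> ('a \<Rightarrow> 'a \<Rightarrow> real) \<Rightarrow> 'a set \<Rightarrow> bool" where
  "geodesic_convex M d S \<longleftrightarrow>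
     S \<subseteq> M \<and>
     (\<forall>p\<in>S. \<forall>q\<in>S. \<exists>!\<gamma>. \<gamma> \<in> extensional {0..1} \<and>
        geodesic_segment M d p q \<gamma> \<and> \<gamma> ` {0..1} \<subseteq> S)"

section \<open>Metric projections and the double-projection property\<close>

definition metric_proj :: "('a \<Rightarrow> 'a \<Rightarrow> real) \<Rightarrow> 'a set \<Rightarrow> 'a \<Rightarrow> 'a set" where
  "metric_proj d S q = {s \<in> S. d q s = (INF z\<in>S. d q z)}"

definition proximinal :: "'a set \<Rightarrow> ('a \<Rightarrow> 'a \<Rightarrow> real) \<Rightarrow> 'a set \<Rightarrow> bool" where
  "proximinal M d S \<longleftrightarrow> (\<forall>q\<in>M. metric_proj d S q \<noteq> {})"

definition proj_comp ::
    "('a \<Rightarrow> 'a \<Rightarrow> real) \<Rightarrow> 'a set \<Rightarrow> 'a set \<Rightarrow> 'a \<Rightarrow> 'a set" where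
  "proj_comp d S1 S2 q = (\<Union>s\<in>metric_proj d S2 q. metric_proj d S1 s)"

definition DP1 :: "('a \<Rightarrow> 'a \<Rightarrow> real) \<Rightarrow> 'a set \<Rightarrow> 'a set \<Rightarrow> 'a \<Rightarrow> bool" where
  "DP1 d S1 S2 q \<longleftrightarrow> q \<in> proj_comp d S1 S2 q"

definition DP2 :: "('a \<Rightarrow> 'a \<Rightarrow> real) \<Rightarrow> 'a set \<Rightarrow> 'a set \<Rightarrow> 'a \<Rightarrow> bool" where
  "DP2 d S1 S2 q \<longleftrightarrow>
     (\<exists>q'\<in>metric_proj d S2 q. \<forall>z1\<in>S1. \<forall>z2\<in>S2. d q q' \<le> d z1 z2)"

definition global_double_projection :: "'a set \<Rightarrow> ('a \<Rightarrow> 'a \<Rightarrow> real) \<Rightarrow> bool" where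
  "global_double_projection M d \<longleftrightarrow>
     geodesic_length_space M d \<and>
     (\<forall>S1 S2. S1 \<noteq> {} \<and> S2 \<noteq> {} \<and>
        geodesic_convex M d S1 \<and> proximinal M d S1 \<and>
        geodesic_convex M d S2 \<and> proximinal M d S2 \<longrightarrow>
        (\<forall>q\<in>S1. DP1 d S1 S2 q \<longleftrightarrow> DP2 d S1 S2 q))"

end

theory Submission
  imports Defs
begin

text \<open>The argument rests on supporting functionals. For \<open>z \<noteq> 0\<close> the derivative \<open>D z\<close> of \<open>F\<close> at \<open>z\<close> is a
  linear functional with \<open>D z z = F z\<close> and \<open>D z x \<le> F x\<close> for all \<open>x\<close>, with equality only if \<open>x\<close> lies
  on the ray through \<open>z\<close> (\<open>D_le_and_eq\<close>). This is where positive definiteness of the Hessian of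
  \<open>F\<^sup>2 / 2\<close> enters: that function lies strictly above its tangent planes along segments that
  avoid the origin, and homogeneity reduces the bound on \<open>D z x\<close> to that case.

  The triangle inequality follows by applying \<open>D (x + y)\<close> to both summands, and its equality case
  shows that every geodesic segment is an affinely parametrized straight segment
  (\<open>geodesic_segment_imp_line\<close>). Hence geodesic convex sets are convex.

  For the double projection let \<open>s\<close> be nearest to \<open>q \<in> S1\<close> in \<open>S2\<close> and \<open>q\<close> nearest to \<open>s\<close> in \<open>S1\<close>, with
  \<open>s \<noteq> q\<close>. Minimality makes \<open>D (s - q)\<close> nonnegative on \<open>z2 - s\<close> for \<open>z2 \<in> S2\<close> and, since \<open>D (- z) = - D z\<close>
  for a reversible norm, nonpositive on \<open>z1 - q\<close> for \<open>z1 \<in> S1\<close>. So one and the same functional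
  separates both sets:
  \<open>F (s - q) = D (s - q) (s - q) \<le> D (s - q) (z2 - z1) \<le> F (z2 - z1)\<close>,
  which is the minimality over all pairs. The converse implication follows from the
  symmetry of the distance.\<close>

section \<open>Convexity along segments from the Hessian\<close>

lemma frechet_derivative_partial_deriv:
  fixes f :: "real^'n \<Rightarrow> real"
  assumes "f differentiable (at x)"
  shows "frechet_derivative f (at x) v = (\<Sum>i\<in>UNIV. v $ i * partial_deriv i f x)"
proof -
  have lin: "linear (frechet_derivative f (at x))"
    using assms linear_frechet_derivative by blast
  have "frechet_derivative f (at x) v
      = frechet_derivative f (at x) (\<Sum>i\<in>UNIV. (v $ i) *\<^sub>R axis i 1)"
    by (simp add: basis_expansion scalar_mult_eq_scaleR[symmetric])
  also have "\<dots> = (\<Sum>i\<in>UNIV. v $ i * partial_deriv i f x)"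
    by (simp add: linear_sum[OF lin] linear_scale[OF lin] partial_deriv_def)
  finally show ?thesis .
qed

lemma DERIV_along_line:
  fixes f :: "real^'n \<Rightarrow> real"
  assumes "f differentiable (at (z + t *\<^sub>R v))"
  shows "((\<lambda>t. f (z + t *\<^sub>R v)) has_real_derivative
           (\<Sum>i\<in>UNIV. v $ i * partial_deriv i f (z + t *\<^sub>R v))) (at t)"
proof -
  let ?D = "frechet_derivative f (at (z + t *\<^sub>R v))"
  have f: "(f has_derivative ?D) (at (z + t *\<^sub>R v))"
    using assms frechet_derivative_works by blast
  have l: "((\<lambda>t. z + t *\<^sub>R v) has_derivative (\<lambda>h. h *\<^sub>R v)) (at t)"
    by (auto intro!: derivative_eq_intros)
  have "((\<lambda>t. f (z + t *\<^sub>R v)) has_derivative (\<lambda>h. ?D (h *\<^sub>R v))) (at t)"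
    using diff_chain_at[OF l f] by (simp add: o_def)
  moreover have "?D (h *\<^sub>R v) = ?D v * h" for h
    using linear_scale[OF linear_frechet_derivative[OF assms]] by (simp add: mult.commute)
  ultimately show ?thesis
    by (simp add: has_field_derivative_def frechet_derivative_partial_deriv[OF assms, symmetric])
qed

text \<open>The restriction of \<open>f\<close> to the segment has the positive second derivative
  \<open>v \<bullet> (hessian f u *v v)\<close> with \<open>v = x - z\<close>. So its first derivative increases strictly, and by the
  mean value theorem the increment of \<open>f\<close> exceeds the slope at \<open>z\<close>.\<close>

lemma positive_definite_hessian_strict_first_order:
  fixes f :: "real^'n \<Rightarrow> real"
  assumes seg: "closed_segment z x \<subseteq> S" and "x \<noteq> z"
    and d1: "\<And>u. u \<in> S \<Longrightarrow> f differentiable (at u)"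
    and d2: "\<And>u j. u \<in> S \<Longrightarrow> partial_deriv j f differentiable (at u)"
    and pos: "\<And>u. u \<in> S \<Longrightarrow> positive_definite (hessian f u)"
  shows "f z + frechet_derivative f (at z) (x - z) < f x"
proof -
  define v where "v = x - z"
  have "v \<noteq> 0" using \<open>x \<noteq> z\<close> by (simp add: v_def)
  define g1 where "g1 t = (\<Sum>j\<in>UNIV. v $ j * partial_deriv j f (z + t *\<^sub>R v))" for t
  have inS: "z + t *\<^sub>R v \<in> S" if "0 \<le> t" "t \<le> 1" for t
  proof -
    have "z + t *\<^sub>R v = (1 - t) *\<^sub>R z + t *\<^sub>R x"
      by (simp add: v_def algebra_simps)
    moreover have "\<dots> \<in> closed_segment z x"
      using that by (auto simp: in_segment)
    ultimately show ?thesis using seg by auto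
  qed
  have D1: "((\<lambda>t. f (z + t *\<^sub>R v)) has_real_derivative g1 t) (at t)" if "0 \<le> t" "t \<le> 1" for t
    unfolding g1_def using d1[OF inS[OF that]] by (rule DERIV_along_line)
  have D2: "\<exists>y. (g1 has_real_derivative y) (at t) \<and> y > 0" if "0 \<le> t" "t \<le> 1" for t
  proof -
    let ?u = "z + t *\<^sub>R v"
    let ?y = "\<Sum>j\<in>UNIV. v $ j * (\<Sum>i\<in>UNIV. v $ i * partial_deriv i (partial_deriv j f) ?u)"
    have "(g1 has_real_derivative ?y) (at t)"
      unfolding g1_def
      by (intro DERIV_sum DERIV_cmult DERIV_along_line d2 inS that)
    moreover have "?y = v \<bullet> (hessian f ?u *v v)"
      unfolding inner_vec_def matrix_vector_mult_def hessian_def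
      by (simp add: sum_distrib_left) (subst sum.swap, simp add: mult_ac)
    moreover have "v \<bullet> (hessian f ?u *v v) > 0"
      using pos[OF inS[OF that]] \<open>v \<noteq> 0\<close> unfolding positive_definite_def by blast
    ultimately show ?thesis by auto
  qed
  obtain c where c: "0 < c" "c < 1" "f (z + 1 *\<^sub>R v) - f (z + 0 *\<^sub>R v) = (1 - 0) * g1 c"
    using MVT2[of 0 1 "\<lambda>t. f (z + t *\<^sub>R v)" g1] D1 by auto
  have "g1 0 < g1 c"
    using c by (intro DERIV_pos_imp_increasing[of 0 c g1]) (use D2 in auto)
  moreover have "z \<in> S" using inS[of 0] by simp
  then have "g1 0 = frechet_derivative f (at z) v"
    by (simp add: g1_def frechet_derivative_partial_deriv d1)
  ultimately show ?thesis using c by (simp add: v_def)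
qed

section \<open>Supporting functionals of a reversible Minkowski norm\<close>

locale reversible_minkowski_norm =
  fixes F :: "real^'n \<Rightarrow> real"
  assumes minkowski: "minkowski_norm F" and reversible: "reversible F"
begin

lemma nonneg: "0 \<le> F y"
  using minkowski by (simp add: minkowski_norm_def)

lemma scale: "F (t *\<^sub>R y) = \<bar>t\<bar> * F y"
  using reversible by (simp add: reversible_def)

lemma zero [simp]: "F 0 = 0"
  using scale[of 0 0] by simp

lemma minus [simp]: "F (- y) = F y"
  using scale[of "-1" y] by simp

lemma minus_commute: "F (x - y) = F (y - x)"
  using minus[of "x - y"] by simp

lemma differentiable: "y \<noteq> 0 \<Longrightarrow> F differentiable (at y)"
  and partial_deriv_differentiable: "y \<noteq> 0 \<Longrightarrow> partial_deriv j F differentiable (at y)"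
  using minkowski by (auto simp: minkowski_norm_def numeral_2_eq_2)

abbreviation D where "D z \<equiv> frechet_derivative F (at z)"

lemma has_derivative_D: "z \<noteq> 0 \<Longrightarrow> (F has_derivative D z) (at z)"
  by (rule frechet_derivative_works[THEN iffD1, OF differentiable])

lemma linear_D: "z \<noteq> 0 \<Longrightarrow> linear (D z)"
  by (rule linear_frechet_derivative[OF differentiable])

lemma DERIV_D:
  assumes "z \<noteq> 0"
  shows "((\<lambda>t. F (z + t *\<^sub>R v)) has_real_derivative D z v) (at 0)"
proof -
  have "F differentiable (at (z + 0 *\<^sub>R v))"
    using differentiable[OF assms] by simp
  from DERIV_along_line[OF this]
  show ?thesis
    unfolding frechet_derivative_partial_deriv[OF differentiable[OF assms]]
    by (simp only: scaleR_zero_left add_0_right)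
qed

text \<open>Euler's identity for a function that is homogeneous of degree one.\<close>

lemma D_self:
  assumes "z \<noteq> 0"
  shows "D z z = F z"
proof -
  have "((\<lambda>t. (1 + t) * F z) has_real_derivative F z) (at 0)"
    by (auto intro!: derivative_eq_intros)
  moreover have "(1 + t) * F z = F (z + t *\<^sub>R z)" if "t \<in> {-1<..<1}" for t
    using scale[of "1 + t" z] that by (simp add: algebra_simps)
  ultimately have "((\<lambda>t. F (z + t *\<^sub>R z)) has_real_derivative F z) (at 0)"
    by (elim has_field_derivative_transform_within_open[where S = "{-1<..<1}"]) simp_all
  with DERIV_D[OF assms, of z] show ?thesis
    by (rule DERIV_unique)
qed

lemma energy_has_derivative:
  assumes "z \<noteq> 0"
  shows "((\<lambda>x. (F x)\<^sup>2 / 2) has_derivative (\<lambda>h. F z * D z h)) (at z)"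
proof -
  have "((\<lambda>x. F x * F x) has_derivative (\<lambda>h. F z * D z h + D z h * F z)) (at z)"
    by (intro has_derivative_mult has_derivative_D assms)
  from has_derivative_mult_right[OF this, of "1 / 2"] show ?thesis
    by (simp add: power2_eq_square mult.commute)
qed

lemma energy_frechet_derivative:
  "z \<noteq> 0 \<Longrightarrow> frechet_derivative (\<lambda>x. (F x)\<^sup>2 / 2) (at z) = (\<lambda>h. F z * D z h)"
  by (rule frechet_derivative_at[symmetric]) (rule energy_has_derivative)

text \<open>Near \<open>z\<close> this partial derivative is the product of \<open>F\<close> with a partial derivative of \<open>F\<close>.\<close>

lemma energy_partial_deriv_differentiable:
  assumes "z \<noteq> 0"
  shows "partial_deriv j (\<lambda>x. (F x)\<^sup>2 / 2) differentiable (at z)"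
proof -
  have "(\<lambda>x. F x * partial_deriv j F x) differentiable (at z)"
    by (intro differentiable_mult differentiable partial_deriv_differentiable assms)
  then obtain A where A: "((\<lambda>x. F x * partial_deriv j F x) has_derivative A) (at z)"
    unfolding differentiable_def by blast
  have "(partial_deriv j (\<lambda>x. (F x)\<^sup>2 / 2) has_derivative A) (at z)"
    by (rule has_derivative_transform_within_open[OF A, of "- {0}"])
       (use assms in \<open>auto simp: partial_deriv_def energy_frechet_derivative\<close>)
  then show ?thesis unfolding differentiable_def by blast
qed

lemma energy_strict_first_order:
  assumes "0 \<notin> closed_segment z x" "x \<noteq> z"
  shows "(F z)\<^sup>2 / 2 + F z * D z (x - z) < (F x)\<^sup>2 / 2"
proof -
  have "z \<noteq> 0" using assms by auto
  have "(F z)\<^sup>2 / 2 + frechet_derivative (\<lambda>x. (F x)\<^sup>2 / 2) (at z) (x - z) < (F x)\<^sup>2 / 2"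
  proof (rule positive_definite_hessian_strict_first_order[where S = "- {0}"])
    show "closed_segment z x \<subseteq> - {0}" using assms by auto
    show "(\<lambda>x. (F x)\<^sup>2 / 2) differentiable (at u)" if "u \<in> - {0}" for u
      using that energy_has_derivative unfolding differentiable_def by blast
    show "positive_definite (hessian (\<lambda>x. (F x)\<^sup>2 / 2) u)" if "u \<in> - {0}" for u
      using that minkowski by (simp add: minkowski_norm_def)
  qed (use assms energy_partial_deriv_differentiable in auto)
  then show ?thesis by (simp add: energy_frechet_derivative \<open>z \<noteq> 0\<close>)
qed

text \<open>If \<open>F\<close> vanished at \<open>y\<close>, it would vanish on the whole ray, which contradicts the strict tangent
  inequality between \<open>y\<close> and \<open>2 *\<^sub>R y\<close>.\<close>

lemma pos:
  assumes "y \<noteq> 0"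
  shows "0 < F y"
proof -
  have "0 \<notin> closed_segment y (2 *\<^sub>R y)"
  proof
    assume "0 \<in> closed_segment y (2 *\<^sub>R y)"
    then obtain u where u: "0 \<le> u" "0 = (1 - u) *\<^sub>R y + u *\<^sub>R 2 *\<^sub>R y"
      by (auto simp: in_segment)
    then have "(1 - u + u * 2) *\<^sub>R y = 0" by (simp only: scaleR_add_left scaleR_scaleR)
    then show False using u(1) assms by auto
  qed
  moreover have "2 *\<^sub>R y \<noteq> y" using assms by (simp add: scaleR_2)
  ultimately have "(F y)\<^sup>2 / 2 + F y * D y (2 *\<^sub>R y - y) < (F (2 *\<^sub>R y))\<^sup>2 / 2"
    by (rule energy_strict_first_order)
  then have "F y \<noteq> 0" by (auto simp: scale)
  then show ?thesis using nonneg[of y] by simp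
qed

lemma eq_0_iff: "F y = 0 \<longleftrightarrow> y = 0"
  using pos[of y] by fastforce

text \<open>If \<open>x\<close> is a nonpositive multiple of \<open>z\<close>, both sides are explicit. Otherwise \<open>x\<close> can be rescaled to
  \<open>r *\<^sub>R x\<close> with \<open>F (r *\<^sub>R x) = F z\<close>, on a segment from \<open>z\<close> that misses the origin. Unless \<open>r *\<^sub>R x = z\<close>, the
  strict tangent inequality for \<open>F\<^sup>2 / 2\<close> then loses its quadratic terms and leaves
  \<open>D z (r *\<^sub>R x - z) < 0\<close>.\<close>

lemma D_le_and_eq:
  assumes "z \<noteq> 0"
  shows "D z x \<le> F x \<and> (D z x = F x \<longrightarrow> (\<exists>a\<ge>0. x = a *\<^sub>R z))"
proof -
  note lin = linear_D[OF assms]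
  consider (ray) c where "c \<ge> 0" "x = - (c *\<^sub>R z)" | (off) "x \<noteq> 0" "\<And>c. c \<ge> 0 \<Longrightarrow> x \<noteq> - (c *\<^sub>R z)"
    by (metis order_refl scale_eq_0_iff neg_equal_0_iff_equal)
  then show ?thesis
  proof cases
    case ray
    then have "D z x = - c * F z" "F x = c * F z"
      using linear_scale[OF lin, of "-c" z] D_self[OF assms] scale[of "-c" z] by auto
    moreover have "c = 0" if "- c * F z = c * F z"
      using that pos[OF assms] by simp
    moreover have "- c * F z \<le> c * F z"
      using ray(1) nonneg[of z] by simp
    ultimately show ?thesis using ray by auto
  next
    case off
    define r where "r = F z / F x"
    have r: "r > 0" using pos off(1) assms by (simp add: r_def)
    have Fr: "F (r *\<^sub>R x) = F z"
      using r pos[OF off(1)] by (simp add: scale) (simp add: r_def)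
    show ?thesis
    proof (cases "r *\<^sub>R x = z")
      case True
      then have x: "x = (1 / r) *\<^sub>R z" using r by auto
      then have "D z x = F x"
        using linear_scale[OF lin, of "1 / r" z] D_self[OF assms] scale[of "1 / r" z] r by simp
      then show ?thesis using x r by (intro conjI impI exI[of _ "1 / r"]) auto
    next
      case False
      have "0 \<notin> closed_segment z (r *\<^sub>R x)"
      proof
        assume "0 \<in> closed_segment z (r *\<^sub>R x)"
        then obtain u where u: "0 \<le> u" "u \<le> 1" "0 = (1 - u) *\<^sub>R z + u *\<^sub>R r *\<^sub>R x"
          by (auto simp: in_segment)
        have "u \<noteq> 0" using u(3) assms by auto
        have "(u * r) *\<^sub>R x = - ((1 - u) *\<^sub>R z)"
          using u(3) by (simp add: eq_neg_iff_add_eq_0 add.commute)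
        then have "(1 / (u * r)) *\<^sub>R ((u * r) *\<^sub>R x) = - (((1 - u) / (u * r)) *\<^sub>R z)"
          by (simp only: scaleR_minus_right scaleR_scaleR) simp
        then have "x = - (((1 - u) / (u * r)) *\<^sub>R z)"
          using \<open>u \<noteq> 0\<close> r by simp
        then show False using off(2)[of "(1 - u) / (u * r)"] u r by simp
      qed
      from energy_strict_first_order[OF this False]
      have "F z * D z (r *\<^sub>R x - z) < 0" by (simp add: Fr)
      then have "D z (r *\<^sub>R x - z) < 0" using pos[OF assms] by (simp add: mult_less_0_iff)
      then have "r * D z x < F z"
        using linear_diff[OF lin] linear_scale[OF lin] D_self[OF assms] by simp
      also have "F z = r * F x" using Fr r by (simp add: scale)
      finally show ?thesis using r by simp
    qed
  qed
qed

lemma D_le: "z \<noteq> 0 \<Longrightarrow> D z x \<le> F x"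
  by (rule D_le_and_eq[THEN conjunct1])

lemma D_eq_imp_ray: "z \<noteq> 0 \<Longrightarrow> D z x = F x \<Longrightarrow> \<exists>a\<ge>0. x = a *\<^sub>R z"
  by (rule D_le_and_eq[THEN conjunct2, rule_format])

lemma triangle: "F (x + y) \<le> F x + F y"
proof (cases "x + y = 0")
  case False
  have "F (x + y) = D (x + y) x + D (x + y) y"
    using linear_add[OF linear_D[OF False]] D_self[OF False] by metis
  then show ?thesis using D_le[OF False, of x] D_le[OF False, of y] by simp
qed (simp add: nonneg)

lemma triangle_eq_imp_ray:
  assumes "x + y \<noteq> 0" "F x + F y \<le> F (x + y)"
  shows "\<exists>a\<ge>0. x = a *\<^sub>R (x + y)"
proof -
  have "F (x + y) = D (x + y) x + D (x + y) y"
    using linear_add[OF linear_D[OF assms(1)]] D_self[OF assms(1)] by metis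
  then have "D (x + y) x = F x"
    using D_le[OF assms(1), of x] D_le[OF assms(1), of y] assms(2) by simp
  then show ?thesis by (rule D_eq_imp_ray[OF assms(1)])
qed

lemma Metric_space_minkowski_dist: "Metric_space UNIV (minkowski_dist F)"
proof
  fix x y z
  show "minkowski_dist F x z \<le> minkowski_dist F x y + minkowski_dist F y z"
    using triangle[of "y - x" "z - y"] by (simp add: minkowski_dist_def)
qed (auto simp: minkowski_dist_def nonneg eq_0_iff minus_commute)

end

section \<open>Geodesics are straight\<close>

lemma curve_length_upper:
  fixes t :: "nat \<Rightarrow> real"
  assumes "t 0 = a" "t m = b" "\<And>i. i \<in> {1..m} \<Longrightarrow> t (i - 1) < t i"
  shows "ereal (\<Sum>i=1..m. d (\<gamma> (t (i - 1))) (\<gamma> (t i))) \<le> curve_length d \<gamma> a b"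
  unfolding curve_length_def
  by (rule Sup_upper, rule CollectI, rule exI[of _ m], rule exI[of _ t]) (use assms in blast)

text \<open>The sum over every partition telescopes to the same value.\<close>

lemma curve_length_eqI:
  assumes "a \<le> b"
    and eq: "\<And>s t. a \<le> s \<Longrightarrow> s \<le> t \<Longrightarrow> t \<le> b \<Longrightarrow> d (\<gamma> s) (\<gamma> t) = c * (t - s)"
  shows "curve_length d \<gamma> a b = ereal (c * (b - a))"
proof -
  have sum: "(\<Sum>i=1..m. d (\<gamma> (t (i - 1))) (\<gamma> (t i))) = c * (b - a)"
    if t: "t 0 = a" "t m = b" "\<forall>i\<in>{1..m}. t (i - 1) < t i" for m :: nat and t
  proof -
    have mono: "t i \<le> t j" if "i \<le> j" "j \<le> m" for i j
      using that
    proof (induction rule: dec_induct)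
      case (step k)
      then show ?case using t(3)[rule_format, of "Suc k"] by simp
    qed simp
    have "(\<Sum>i=1..m. d (\<gamma> (t (i - 1))) (\<gamma> (t i))) = (\<Sum>i=1..m. c * (t i - t (i - 1)))"
    proof (rule sum.cong[OF refl])
      fix i assume i: "i \<in> {1..m}"
      show "d (\<gamma> (t (i - 1))) (\<gamma> (t i)) = c * (t i - t (i - 1))"
        using mono[of 0 "i - 1"] mono[of "i - 1" i] mono[of i m] t(1,2) i by (intro eq) auto
    qed
    also have "\<dots> = c * (\<Sum>i=1..m. t i - t (i - 1))"
      by (simp add: sum_distrib_left)
    also have "(\<Sum>i=1..m. t i - t (i - 1)) = t m - t 0"
      using sum_telescope''[of 0 m t] by simp
    finally show ?thesis using t by simp
  qed
  show ?thesis
  proof (rule antisym)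
    show "curve_length d \<gamma> a b \<le> ereal (c * (b - a))"
      unfolding curve_length_def using sum by (intro Sup_least) force
    \<comment> \<open>One partition attains the value; partitions increase strictly, so \<open>a = b\<close> needs \<open>m = 0\<close>.\<close>
    let ?m = "if a = b then 0 else 1 :: nat" and ?t = "\<lambda>i :: nat. if i = 0 then a else b"
    have "ereal (\<Sum>i=1..?m. d (\<gamma> (?t (i - 1))) (\<gamma> (?t i))) \<le> curve_length d \<gamma> a b"
      using \<open>a \<le> b\<close> by (intro curve_length_upper) (auto split: if_splits)
    moreover have "(\<Sum>i=1..?m. d (\<gamma> (?t (i - 1))) (\<gamma> (?t i))) = c * (b - a)"
      using \<open>a \<le> b\<close> by (intro sum) (auto split: if_splits)
    ultimately show "ereal (c * (b - a)) \<le> curve_length d \<gamma> a b" by simp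
  qed
qed

text \<open>The first bound is the one-step partition of \<open>[0, t]\<close>. For the second, every partition of
  \<open>[0, t]\<close> is extended by the point \<open>1\<close>; hence the length over \<open>[0, t]\<close>, which is \<open>t * d p q\<close>, plus
  \<open>d (\<gamma> t) q\<close> is at most \<open>d p q\<close>.\<close>

lemma geodesic_segment_dist_le:
  assumes geo: "geodesic_segment M d p q \<gamma>" and t: "0 < t" "t < 1"
  shows "d p (\<gamma> t) \<le> t * d p q" "d (\<gamma> t) q \<le> (1 - t) * d p q"
proof -
  have ends: "\<gamma> 0 = p" "\<gamma> 1 = q" and len1: "curve_length d \<gamma> 0 1 = ereal (d p q)"
    and lent: "curve_length d \<gamma> 0 t = ereal (t * d p q)"
    using geo t by (auto simp: geodesic_segment_def)
  have "ereal (\<Sum>i=1..1. d (\<gamma> (real (i - 1) * t)) (\<gamma> (real i * t))) \<le> curve_length d \<gamma> 0 t"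
    using t by (intro curve_length_upper) auto
  then show "d p (\<gamma> t) \<le> t * d p q"
    by (simp add: lent ends)
  have "curve_length d \<gamma> 0 t \<le> ereal (d p q - d (\<gamma> t) q)"
    unfolding curve_length_def
  proof (rule Sup_least)
    fix l
    assume "l \<in> {ereal (\<Sum>i=1..m. d (\<gamma> (s (i - 1))) (\<gamma> (s i))) | (m::nat) (s::nat \<Rightarrow> real).
      s 0 = 0 \<and> s m = t \<and> (\<forall>i\<in>{1..m}. s (i - 1) < s i)}"
    then obtain m :: nat and s :: "nat \<Rightarrow> real"
      where l: "l = ereal (\<Sum>i=1..m. d (\<gamma> (s (i - 1))) (\<gamma> (s i)))"
        and s: "s 0 = 0" "s m = t" "\<forall>i\<in>{1..m}. s (i - 1) < s i"
      by blast
    let ?s = "s(Suc m := 1)"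
    have "ereal (\<Sum>i=1..Suc m. d (\<gamma> (?s (i - 1))) (\<gamma> (?s i))) \<le> curve_length d \<gamma> 0 1"
    proof (rule curve_length_upper)
      show "?s (i - 1) < ?s i" if "i \<in> {1..Suc m}" for i
        using that s t by (cases "i = Suc m") auto
    qed (use s in auto)
    moreover have "(\<Sum>i=1..Suc m. d (\<gamma> (?s (i - 1))) (\<gamma> (?s i)))
        = (\<Sum>i=1..m. d (\<gamma> (s (i - 1))) (\<gamma> (s i))) + d (\<gamma> t) q"
    proof -
      have "(\<Sum>i=1..m. d (\<gamma> (?s (i - 1))) (\<gamma> (?s i))) = (\<Sum>i=1..m. d (\<gamma> (s (i - 1))) (\<gamma> (s i)))"
        by (intro sum.cong) auto
      then show ?thesis using s by (simp add: ends)
    qed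
    ultimately show "l \<le> ereal (d p q - d (\<gamma> t) q)"
      by (simp add: l len1)
  qed
  then show "d (\<gamma> t) q \<le> (1 - t) * d p q"
    by (simp add: lent algebra_simps)
qed

context reversible_minkowski_norm
begin

lemma geodesic_segment_line:
  "geodesic_segment UNIV (minkowski_dist F) p q (\<lambda>t. p + t *\<^sub>R (q - p))"
proof -
  interpret M: Metric_space UNIV "minkowski_dist F" by (rule Metric_space_minkowski_dist)
  let ?l = "\<lambda>t. p + t *\<^sub>R (q - p)"
  have dist: "minkowski_dist F (?l s) (?l t) = F (q - p) * \<bar>t - s\<bar>" for s t
  proof -
    have "?l t - ?l s = (t - s) *\<^sub>R (q - p)" by (simp add: algebra_simps)
    then show ?thesis by (simp add: minkowski_dist_def scale mult.commute)
  qed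
  have cont: "continuous_map (top_of_set {0..1}) M.mtopology ?l"
    unfolding M.continuous_map_to_metric
  proof (intro ballI allI impI)
    fix x e :: real
    assume x: "x \<in> topspace (top_of_set {0..1})" and "e > 0"
    let ?U = "{0..1} \<inter> ball x (e / (F (q - p) + 1))"
    have F1: "F (q - p) + 1 > 0" using nonneg[of "q - p"] by simp
    have near: "minkowski_dist F (?l x) (?l y) < e" if "y \<in> ?U" for y
    proof -
      have le: "minkowski_dist F (?l x) (?l y) \<le> (F (q - p) + 1) * \<bar>y - x\<bar>"
        unfolding dist by (intro mult_right_mono) auto
      have "\<bar>y - x\<bar> < e / (F (q - p) + 1)"
        using that by (simp add: dist_real_def abs_minus_commute)
      then have less: "(F (q - p) + 1) * \<bar>y - x\<bar> < e"
        using F1 by (simp add: pos_less_divide_eq mult.commute)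
      from le less show ?thesis by (rule le_less_trans)
    qed
    have "openin (top_of_set {0..1}) ?U" by (simp add: openin_open_Int)
    moreover have "x \<in> ?U" using x F1 \<open>e > 0\<close> by simp
    moreover have "\<forall>y\<in>?U. ?l y \<in> M.mball (?l x) e" using near unfolding M.in_mball by blast
    ultimately show "\<exists>U. openin (top_of_set {0..1}) U \<and> x \<in> U \<and> (\<forall>y\<in>U. ?l y \<in> M.mball (?l x) e)"
      by blast
  qed
  have len: "curve_length (minkowski_dist F) ?l 0 t = ereal (F (q - p) * (t - 0))"
    if "0 \<le> t" for t
    by (intro curve_length_eqI that) (simp only: dist abs_of_nonneg diff_ge_0_iff_ge)
  have len1: "curve_length (minkowski_dist F) ?l 0 1 = ereal (minkowski_dist F p q)"
    using len[of 1] by (simp add: minkowski_dist_def)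
  have lent: "curve_length (minkowski_dist F) ?l 0 t
      = ereal t * curve_length (minkowski_dist F) ?l 0 1" if "t \<in> {0..1}" for t
    using that by (subst (1 2) len) (auto simp: mult.commute)
  have ends: "?l 0 = p" "?l 1 = q" by simp_all
  show ?thesis
    unfolding geodesic_segment_def by (intro conjI ballI cont ends len1 lent)
qed

text \<open>The two distance bounds for a geodesic add up to \<open>F (q - p)\<close>, so the triangle inequality through
  \<open>\<gamma> t\<close> is an equality. This puts \<open>\<gamma> t\<close> on the ray from \<open>p\<close> through \<open>q\<close>, at a multiple \<open>a\<close> which the same
  two bounds squeeze to \<open>t\<close>.\<close>

lemma geodesic_segment_imp_line:
  assumes geo: "geodesic_segment UNIV (minkowski_dist F) p q \<gamma>" and t: "t \<in> {0..1}"
  shows "\<gamma> t = p + t *\<^sub>R (q - p)"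
proof -
  have ends: "\<gamma> 0 = p" "\<gamma> 1 = q" using geo[unfolded geodesic_segment_def] by - (elim conjE, assumption)+
  consider "t = 0" | "t = 1" | "0 < t" "t < 1" using t by fastforce
  then show ?thesis
  proof cases
    case 3
    from geodesic_segment_dist_le[OF geo 3]
    have le: "F (\<gamma> t - p) \<le> t * F (q - p)" "F (q - \<gamma> t) \<le> (1 - t) * F (q - p)"
      by (auto simp: minkowski_dist_def)
    show ?thesis
    proof (cases "q = p")
      case True
      then show ?thesis using le nonneg[of "\<gamma> t - p"] eq_0_iff[of "\<gamma> t - p"] by simp
    next
      case False
      have "\<exists>a\<ge>0. \<gamma> t - p = a *\<^sub>R ((\<gamma> t - p) + (q - \<gamma> t))"
        using le False by (intro triangle_eq_imp_ray) (auto simp: algebra_simps)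
      then obtain a where a: "a \<ge> 0" "\<gamma> t - p = a *\<^sub>R (q - p)" by auto
      then have "q - \<gamma> t = (1 - a) *\<^sub>R (q - p)" by (simp add: algebra_simps)
      then have "a * F (q - p) \<le> t * F (q - p)" "\<bar>1 - a\<bar> * F (q - p) \<le> (1 - t) * F (q - p)"
        using le a by (simp_all add: scale)
      moreover have "F (q - p) > 0" using pos False by simp
      ultimately have "a = t" by simp
      then show ?thesis using a(2) by (simp add: algebra_simps)
    qed
  qed (simp_all add: ends)
qed

lemma geodesic_length_space: "geodesic_length_space UNIV (minkowski_dist F)"
  unfolding geodesic_length_space_def
  by (intro conjI ballI Metric_space_minkowski_dist) (rule exI, rule geodesic_segment_line)

lemma geodesic_convex_imp_convex:
  assumes "geodesic_convex UNIV (minkowski_dist F) S"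
  shows "convex S"
  unfolding convex_contains_segment
proof (intro ballI subsetI)
  fix p q x assume "p \<in> S" "q \<in> S" "x \<in> closed_segment p q"
  then obtain \<gamma> where \<gamma>: "geodesic_segment UNIV (minkowski_dist F) p q \<gamma>" "\<gamma> ` {0..1} \<subseteq> S"
    using assms unfolding geodesic_convex_def by (meson ex1_implies_ex)
  from \<open>x \<in> closed_segment p q\<close> obtain u where u: "u \<in> {0..1}" "x = (1 - u) *\<^sub>R p + u *\<^sub>R q"
    by (auto simp: in_segment)
  have "\<gamma> u = p + u *\<^sub>R (q - p)" by (rule geodesic_segment_imp_line[OF \<gamma>(1) u(1)])
  also have "\<dots> = x" unfolding u(2) by (simp add: algebra_simps)
  finally have "x = \<gamma> u" by simp
  then show "x \<in> S" using \<gamma>(2) u(1) by blast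
qed

section \<open>Metric projections\<close>

lemma metric_proj_iff:
  "s \<in> metric_proj (minkowski_dist F) S q \<longleftrightarrow> s \<in> S \<and> (\<forall>z\<in>S. F (s - q) \<le> F (z - q))"
proof -
  have bdd: "bdd_below ((\<lambda>z. F (z - q)) ` S)"
    using nonneg by (intro bdd_belowI[of _ 0]) auto
  have "F (s - q) = (INF z\<in>S. F (z - q)) \<longleftrightarrow> (\<forall>z\<in>S. F (s - q) \<le> F (z - q))" if "s \<in> S"
  proof
    assume "F (s - q) = (INF z\<in>S. F (z - q))"
    then show "\<forall>z\<in>S. F (s - q) \<le> F (z - q)" using cINF_lower[OF bdd] by metis
  next
    assume "\<forall>z\<in>S. F (s - q) \<le> F (z - q)"
    then show "F (s - q) = (INF z\<in>S. F (z - q))"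
      using that by (intro antisym cINF_greatest cINF_lower[OF bdd that]) auto
  qed
  then show ?thesis unfolding metric_proj_def minkowski_dist_def by blast
qed

text \<open>The variational inequality of a nearest point: a negative derivative in the direction of \<open>z\<close>
  would make points of the segment from \<open>s\<close> to \<open>z\<close> strictly closer to \<open>q\<close> than \<open>s\<close>.\<close>

lemma D_nonneg_of_metric_proj:
  assumes "convex S" and s: "s \<in> metric_proj (minkowski_dist F) S q" and "s \<noteq> q" "z \<in> S"
  shows "0 \<le> D (s - q) (z - s)"
proof (rule ccontr)
  assume "\<not> 0 \<le> D (s - q) (z - s)"
  then have "D (s - q) (z - s) < 0" by simp
  from DERIV_neg_dec_right[OF DERIV_D this] \<open>s \<noteq> q\<close>
  obtain e where e: "e > 0" "\<And>h. 0 < h \<Longrightarrow> h < e \<Longrightarrow> F (s - q + h *\<^sub>R (z - s)) < F (s - q)"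
    by auto
  define h where "h = min 1 (e / 2)"
  have h: "0 < h" "h < e" "h \<le> 1" using e(1) by (auto simp: h_def)
  have "(1 - h) *\<^sub>R s + h *\<^sub>R z \<in> S"
    using convexD_alt[OF \<open>convex S\<close>] s \<open>z \<in> S\<close> h by (simp add: metric_proj_iff)
  then have "F (s - q) \<le> F ((1 - h) *\<^sub>R s + h *\<^sub>R z - q)"
    using s by (simp add: metric_proj_iff)
  also have "(1 - h) *\<^sub>R s + h *\<^sub>R z - q = s - q + h *\<^sub>R (z - s)"
    by (simp add: algebra_simps)
  finally show False using e(2)[OF h(1,2)] by simp
qed

lemma D_minus:
  assumes "z \<noteq> 0"
  shows "D (- z) v = - D z v"
proof -
  have "(\<lambda>t. F (- z + t *\<^sub>R v)) = (\<lambda>t. F (z + t *\<^sub>R - v))"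
    using minus by (metis (no_types, opaque_lifting) add.inverse_inverse minus_add_distrib scaleR_minus_right)
  then have "D (- z) v = D z (- v)"
    using DERIV_D[of "- z" v] DERIV_D[of z "- v"] assms DERIV_unique by force
  then show ?thesis using linear_neg[OF linear_D[OF assms]] by simp
qed

text \<open>The functional \<open>D (s - q)\<close> separates both sets by the amount \<open>F (s - q)\<close> because the variational
  inequalities at \<open>s\<close> and at \<open>q\<close> involve opposite vectors and hence, up to sign, the same
  functional.\<close>

lemma DP1_imp_DP2:
  assumes "convex S1" "convex S2" and "DP1 (minkowski_dist F) S1 S2 q"
  shows "DP2 (minkowski_dist F) S1 S2 q"
proof -
  obtain s where s: "s \<in> metric_proj (minkowski_dist F) S2 q"
    and q: "q \<in> metric_proj (minkowski_dist F) S1 s"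
    using assms(3) by (auto simp: DP1_def proj_comp_def)
  have "F (s - q) \<le> F (z2 - z1)" if z: "z1 \<in> S1" "z2 \<in> S2" for z1 z2
  proof (cases "s = q")
    case False
    then have nz: "s - q \<noteq> 0" by simp
    note lin = linear_D[OF nz]
    have "0 \<le> D (s - q) (z2 - s)"
      using D_nonneg_of_metric_proj[OF assms(2) s False z(2)] .
    moreover have "0 \<le> D (q - s) (z1 - q)"
      using D_nonneg_of_metric_proj[OF assms(1) q _ z(1)] False by auto
    then have "D (s - q) (z1 - q) \<le> 0"
      using D_minus[OF nz] by simp
    ultimately have "D (s - q) (s - q) \<le> D (s - q) (z2 - z1)"
      by (simp add: linear_diff[OF lin])
    also have "\<dots> \<le> F (z2 - z1)" by (rule D_le[OF nz])
    finally show ?thesis by (simp add: D_self[OF nz])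
  qed (simp add: nonneg)
  then show ?thesis using s by (auto simp: DP2_def minkowski_dist_def)
qed

lemma DP2_imp_DP1:
  assumes "q \<in> S1" and "DP2 (minkowski_dist F) S1 S2 q"
  shows "DP1 (minkowski_dist F) S1 S2 q"
proof -
  obtain s where s: "s \<in> metric_proj (minkowski_dist F) S2 q"
    and min: "\<And>z1 z2. z1 \<in> S1 \<Longrightarrow> z2 \<in> S2 \<Longrightarrow> F (s - q) \<le> F (z2 - z1)"
    using assms(2) by (auto simp: DP2_def minkowski_dist_def)
  have "s \<in> S2" using s by (simp add: metric_proj_iff)
  then have "q \<in> metric_proj (minkowski_dist F) S1 s"
    using min assms(1) by (auto simp: metric_proj_iff minus_commute[of _ s])
  then show ?thesis using s by (auto simp: DP1_def proj_comp_def)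
qed

end

theorem theorem2p2:
  fixes F :: "real^'n \<Rightarrow> real"
  assumes "minkowski_norm F"
    and "reversible F"
  shows "global_double_projection UNIV (minkowski_dist F)"
proof -
  interpret reversible_minkowski_norm F
    using assms by unfold_locales
  show ?thesis
    unfolding global_double_projection_def
    using geodesic_length_space geodesic_convex_imp_convex DP1_imp_DP2 DP2_imp_DP1 by blast
qed

end
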